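(* Let $(Q,\Delta_Q,A,S)$ be a domain, $(PG,RID)$ an understanding criterion, and $ans:Q\to A$ a question-answering system (agent). Let $\mathcal{A}=\{\alpha_1,\dots,\alpha_k\}$ be a set of explanations (procedures) offered by the agent, with known pairwise disjoint applicability sets $Q_{\alpha_i}\subseteq Q$, such that the agent applies $\alpha_i$ to every question of $Q_{\alpha_i}$ and obtains the same known score $s_{\alpha_i}\in[0,1]$ on all of them, i.e. $S(q,ans(q))=s_{\alpha_i}$ for all $q\in Q_{\alpha_i}$. Let $r_{\alpha_i}=1$ if $s_{\alpha_i}=0$ and $r_{\alpha_i}=0$ otherwise, let $p_{\alpha_i}=P_{q\sim\Delta_Q}(q\in Q_{\alpha_i})$, let $\bar Q=Q\setminus\bigcup_{i}Q_{\alpha_i}$ and $\bar p=1-\sum_{i}p_{\alpha_i}$, with $\bar p>0$. Let $\delta\in(0,1)$ and let $\bar n\ge1$ be an integer. Let $q_1,\dots,q_{\bar n}$ be sampled independently from $\Delta_Q$ restricted to $\bar Q$ and renormalized, put $\bar s_j=S(q_j,ans(q_j))$, $\bar r_j=1$ if $\bar s_j=0$ and $\bar r_j=0$ otherwise, $\hat{\bar s}=\frac1{\bar n}\sum_{j}\bar s_j$ and $\hat{\bar r}=\frac1{\bar n}\sum_{j}\bar r_j$. Consider the following testing procedure: 1. Determine "the agent understands the scope $Q$" if both $$\Big(\sum_{\alpha_i\in\mathcal A}p_{\alpha_i}s_{\alpha_i}\Big)+\bar p\,L(\hat{\bar s},\bar n,\delta)\ge PG\quad\text{and}\quad \Big(\sum_{\alpha_i\in\mathcal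 A}p_{\alpha_i}r_{\alpha_i}\Big)+\bar p\,U(\hat{\bar r},\bar n,\delta)\le RID.$$ 2. Determine "the agent does not understand the scope $Q$" if $$\Big(\sum_{\alpha_i\in\mathcal A}p_{\alpha_i}s_{\alpha_i}\Big)+\bar p\,U(\hat{\bar s},\bar n,\delta/2)< PG\quad\text{or}\quad \Big(\sum_{\alpha_i\in\mathcal A}p_{\alpha_i}r_{\alpha_i}\Big)+\bar p\,L(\hat{\bar r},\bar n,\delta/2)> RID.$$ 3. Otherwise, draw no conclusion. Then whatever conclusion the procedure draws is correct with probability at least $1-\delta$. That is, the probability, over the draw of the samples, that the procedure draws an incorrect conclusion is at most $\delta$: if the agent does not understand the scope $Q$, then the probability that the procedure determines that it understands is at most $\delta$; and if the agent understands the scope $Q$, then the probability that the procedure determines that it does not understand is at most $\delta$.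
   Context: A domain is a tuple $(Q,\Delta_Q,A,S)$ where $Q$ is a set of questions, $\Delta_Q$ is a probability distribution over $Q$, $A$ is a set of answers containing a distinguished element $idk$ ("I don't know"), and $S:Q\times A\to[0,1]$ is a scoring function. (As usual, $q\mapsto S(q,ans(q))$ and the sets $Q_{\alpha_i}$ are assumed measurable.) An answer $a$ to $q$ is ridiculous if $S(q,a)=0$. An understanding criterion is a pair $(PG,RID)$ with $PG\in(0,1)$ and $RID\in(0,1)$ (informally $RID$ is much smaller than $PG$; no quantitative relation is imposed). Put $s=\mathbb{E}_{q\sim\Delta_Q}[S(q,ans(q))]$ and $r=P_{q\sim\Delta_Q}(S(q,ans(q))=0)$. The agent $ans$ understands the scope $Q$ if and only if $s\ge PG$ and $r\le RID$. The set $\mathcal A$, the sets $Q_{\alpha_i}$, and the values $s_{\alpha_i},r_{\alpha_i},p_{\alpha_i}$ are fixed (not random). For $x,y\in[0,1]$ let $d(x,y)=x\ln\frac{x}{y}+(1-x)\ln\frac{1-x}{1-y}$ be the relative entropy between Bernoulli distributions with parameters $x$ and $y$, with singularities replaced by limit values: $d(0,y)=\ln\frac1{1-y}$ for $y\ne1$, $d(1,y)=\ln\frac1y$ for $y\neq 0$ (so $d(0,0)=d(1,1)=0$), and $d(x,y)=\infty$ if $x>0,y=0$ or if $x<1,y=1$. For $x\in[0,1]$, an integer $m\ge1$ and $\delta\in(0,1)$ define $$U(x,m,\delta)=\max\{y\in[0,1]: d(x,y)\le \ln(1/\delta)/m\},\qquad L(x,m,\delta)=\min\{y\in[0,1]: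 d(x,y)\le \ln(1/\delta)/m\}.$$ *)

theory Defs
  imports "HOL-Probability.Probability"
begin

text \<open>The question set \<open>Q\<close> is the space of the distribution \<open>\<Delta>\<close>.\<close>

locale qa_domain = prob_space \<Delta>
  for \<Delta> :: "'q measure" +
  fixes A :: "'a set" and idk :: 'a and S :: "'q \<Rightarrow> 'a \<Rightarrow> real"
  assumes idk_answer: "idk \<in> A"
    and score_range: "\<And>q a. q \<in> space \<Delta> \<Longrightarrow> a \<in> A \<Longrightarrow> S q a \<in> {0..1}"

definition ridiculous :: "('q \<Rightarrow> 'a \<Rightarrow> real) \<Rightarrow> 'q \<Rightarrow> 'a \<Rightarrow> bool" where
  "ridiculous S q a \<longleftrightarrow> S q a = 0"

definition expected_score :: "'q measure \<Rightarrow> ('q \<Rightarrow> 'a \<Rightarrow> real) \<Rightarrow> ('q \<Rightarrow> 'a) \<Rightarrow> real" where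
  "expected_score \<Delta> S ans = (\<integral>q. S q (ans q) \<partial>\<Delta>)"

definition ridiculous_prob :: "'q measure \<Rightarrow> ('q \<Rightarrow> 'a \<Rightarrow> real) \<Rightarrow> ('q \<Rightarrow> 'a) \<Rightarrow> real" where
  "ridiculous_prob \<Delta> S ans = measure \<Delta> {q \<in> space \<Delta>. ridiculous S q (ans q)}"

definition understands ::
  "'q measure \<Rightarrow> ('q \<Rightarrow> 'a \<Rightarrow> real) \<Rightarrow> real \<Rightarrow> real \<Rightarrow> ('q \<Rightarrow> 'a) \<Rightarrow> bool" where
  "understands \<Delta> S PG RID ans \<longleftrightarrow>
     expected_score \<Delta> S ans \<ge> PG \<and> ridiculous_prob \<Delta> S ans \<le> RID"

definition bern_rel_entropy :: "real \<Rightarrow> real \<Rightarrow> ereal" where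
  "bern_rel_entropy x y =
     (if (x > 0 \<and> y = 0) \<or> (x < 1 \<and> y = 1) then \<infinity>
      else if x = 0 then ereal (ln (1 / (1 - y)))
      else if x = 1 then ereal (ln (1 / y))
      else ereal (x * ln (x / y) + (1 - x) * ln ((1 - x) / (1 - y))))"

definition upper_conf :: "real \<Rightarrow> nat \<Rightarrow> real \<Rightarrow> real" where
  "upper_conf x m \<delta> =
     (GREATEST y. y \<in> {0..1} \<and> bern_rel_entropy x y \<le> ereal (ln (1 / \<delta>) / real m))"

definition lower_conf :: "real \<Rightarrow> nat \<Rightarrow> real \<Rightarrow> real" where
  "lower_conf x m \<delta> =
     (LEAST y. y \<in> {0..1} \<and> bern_rel_entropy x y \<le> ereal (ln (1 / \<delta>) / real m))"

text \<open>In the following, \<open>E\<close> is the set of explanations, identified by names of an arbitrary type;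
  \<open>App \<alpha>\<close> is the applicability set of \<open>\<alpha>\<close> and \<open>sc \<alpha>\<close> the score obtained on it.\<close>

definition ridiculous_score :: "real \<Rightarrow> real" where
  "ridiculous_score s = (if s = 0 then 1 else 0)"

definition explained_score ::
  "'q measure \<Rightarrow> 'e set \<Rightarrow> ('e \<Rightarrow> 'q set) \<Rightarrow> ('e \<Rightarrow> real) \<Rightarrow> real" where
  "explained_score \<Delta> E App sc = (\<Sum>\<alpha>\<in>E. measure \<Delta> (App \<alpha>) * sc \<alpha>)"

definition explained_ridiculous ::
  "'q measure \<Rightarrow> 'e set \<Rightarrow> ('e \<Rightarrow> 'q set) \<Rightarrow> ('e \<Rightarrow> real) \<Rightarrow> real" where
  "explained_ridiculous \<Delta> E App sc =
     (\<Sum>\<alpha>\<in>E. measure \<Delta> (App \<alpha>) * ridiculous_score (sc \<alpha>))"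

definition unexplained_set :: "'q measure \<Rightarrow> 'e set \<Rightarrow> ('e \<Rightarrow> 'q set) \<Rightarrow> 'q set" where
  "unexplained_set \<Delta> E App = space \<Delta> - (\<Union>\<alpha>\<in>E. App \<alpha>)"

definition unexplained_prob :: "'q measure \<Rightarrow> 'e set \<Rightarrow> ('e \<Rightarrow> 'q set) \<Rightarrow> real" where
  "unexplained_prob \<Delta> E App = 1 - (\<Sum>\<alpha>\<in>E. measure \<Delta> (App \<alpha>))"

text \<open>The joint law of \<open>n\<close> independent questions drawn from \<open>\<Delta>\<close> conditioned on the unexplained
  set (\<^const>\<open>uniform_measure\<close> restricts a measure to a set and renormalises it).\<close>

definition sample_measure ::
  "'q measure \<Rightarrow> 'e set \<Rightarrow> ('e \<Rightarrow> 'q set) \<Rightarrow> nat \<Rightarrow> (nat \<Rightarrow> 'q) measure" where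
  "sample_measure \<Delta> E App n =
     (\<Pi>\<^sub>M j\<in>{..<n}. uniform_measure \<Delta> (unexplained_set \<Delta> E App))"

definition mean_score ::
  "('q \<Rightarrow> 'a \<Rightarrow> real) \<Rightarrow> ('q \<Rightarrow> 'a) \<Rightarrow> nat \<Rightarrow> (nat \<Rightarrow> 'q) \<Rightarrow> real" where
  "mean_score S ans n qs = (\<Sum>j<n. S (qs j) (ans (qs j))) / real n"

definition mean_ridiculous ::
  "('q \<Rightarrow> 'a \<Rightarrow> real) \<Rightarrow> ('q \<Rightarrow> 'a) \<Rightarrow> nat \<Rightarrow> (nat \<Rightarrow> 'q) \<Rightarrow> real" where
  "mean_ridiculous S ans n qs = (\<Sum>j<n. ridiculous_score (S (qs j) (ans (qs j)))) / real n"

text \<open>The two conclusions of the testing procedure on the sample \<open>qs\<close>; it draws no conclusion when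
  neither predicate holds.\<close>

definition determines_understands ::
  "'q measure \<Rightarrow> ('q \<Rightarrow> 'a \<Rightarrow> real) \<Rightarrow> real \<Rightarrow> real \<Rightarrow> ('q \<Rightarrow> 'a) \<Rightarrow>
   'e set \<Rightarrow> ('e \<Rightarrow> 'q set) \<Rightarrow> ('e \<Rightarrow> real) \<Rightarrow> nat \<Rightarrow> real \<Rightarrow> (nat \<Rightarrow> 'q) \<Rightarrow> bool" where
  "determines_understands \<Delta> S PG RID ans E App sc n \<delta> qs \<longleftrightarrow>
     explained_score \<Delta> E App sc
       + unexplained_prob \<Delta> E App * lower_conf (mean_score S ans n qs) n \<delta> \<ge> PG \<and>
     explained_ridiculous \<Delta> E App sc
       + unexplained_prob \<Delta> E App * upper_conf (mean_ridiculous S ans n qs) n \<delta> \<le> RID"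

definition determines_not_understands ::
  "'q measure \<Rightarrow> ('q \<Rightarrow> 'a \<Rightarrow> real) \<Rightarrow> real \<Rightarrow> real \<Rightarrow> ('q \<Rightarrow> 'a) \<Rightarrow>
   'e set \<Rightarrow> ('e \<Rightarrow> 'q set) \<Rightarrow> ('e \<Rightarrow> real) \<Rightarrow> nat \<Rightarrow> real \<Rightarrow> (nat \<Rightarrow> 'q) \<Rightarrow> bool" where
  "determines_not_understands \<Delta> S PG RID ans E App sc n \<delta> qs \<longleftrightarrow>
     explained_score \<Delta> E App sc
       + unexplained_prob \<Delta> E App * upper_conf (mean_score S ans n qs) n (\<delta> / 2) < PG \<or>
     explained_ridiculous \<Delta> E App sc
       + unexplained_prob \<Delta> E App * lower_conf (mean_ridiculous S ans n qs) n (\<delta> / 2) > RID"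

end

theory Submission
  imports Defs "HOL-Real_Asymp.Real_Asymp"
begin

text \<open>Splitting both \<open>s\<close> and \<open>r\<close> along the applicability sets reduces the theorem to one-sided
  confidence bounds for the mean \<open>\<mu>\<close> of i.i.d. \<open>[0,1]\<close>-valued variables. For fixed \<open>t\<close>, monotonicity
  of the relative entropy in each argument shows that \<open>L(x,m,\<delta>) > t\<close> means \<open>x > x0\<close> for a threshold
  \<open>x0\<close> which is \<open>1\<close> or satisfies \<open>d(x0,t) = ln(1/\<delta>)/m\<close>; taking \<open>t = \<mu>\<close>, Chernoff's bound
  \<open>exp(-m d(x0,\<mu>)) = \<delta>\<close> controls this event. Upper bounds follow by \<open>x \<mapsto> 1 - x\<close>, and the two ways
  of wrongly rejecting cost \<open>\<delta>/2\<close> each.\<close>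

section \<open>Real-valued relative entropy with second argument in (0,1)\<close>

definition kl :: "real \<Rightarrow> real \<Rightarrow> real" where
  "kl x y = x * ln (x / y) + (1 - x) * ln ((1 - x) / (1 - y))"

text \<open>Away from the singularities y = 0 and y = 1 all work can be done in the reals. The limit
  values at x = 0 and x = 1 come out right because a factor 0 cancels the offending
  logarithm.\<close>

lemma bern_rel_entropy_eq_kl:
  assumes "x \<in> {0..1}" "y \<in> {0<..<1}"
  shows "bern_rel_entropy x y = ereal (kl x y)"
  using assms by (auto simp: bern_rel_entropy_def kl_def)

lemma mult_ln_divide:
  fixes x y :: real
  assumes "0 \<le> x" "0 < y"
  shows "x * ln (x / y) = x * ln x - x * ln y"
  using assms by (cases "x = 0") (auto simp: ln_div algebra_simps)

lemma kl_eq: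
  assumes "x \<in> {0..1}" "y \<in> {0<..<1}"
  shows "kl x y = x * ln x - x * ln y + (1 - x) * ln (1 - x) - (1 - x) * ln (1 - y)"
  using assms unfolding kl_def by (simp add: mult_ln_divide)

text \<open>This is ln u \<le> u - 1 at u = y / x, scaled by x. Adding the instances for (x, y) and
  (1 - x, 1 - y) cancels the linear terms, which gives Gibbs' inequality
  \<open>kl_nonneg\<close>.\<close>

lemma mult_ln_divide_ge:
  fixes x y :: real
  assumes "0 \<le> x" "0 < y"
  shows "x * ln (x / y) \<ge> x - y"
proof (cases "x = 0")
  case False
  then have "x > 0" using assms by simp
  have "ln (y / x) \<le> y / x - 1"
    using \<open>x > 0\<close> assms by (intro ln_le_minus_one) auto
  then have "x * ln (y / x) \<le> x * (y / x - 1)"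
    using \<open>x > 0\<close> by (intro mult_left_mono) auto
  moreover have "x * (y / x - 1) = y - x" using \<open>x > 0\<close> by (simp add: field_simps)
  moreover have "ln (y / x) = - ln (x / y)" using \<open>x > 0\<close> assms by (simp add: ln_div)
  ultimately show ?thesis by simp
qed (use assms in auto)

lemma kl_nonneg:
  assumes "x \<in> {0..1}" "y \<in> {0<..<1}"
  shows "kl x y \<ge> 0"
  using mult_ln_divide_ge[of x y] mult_ln_divide_ge[of "1 - x" "1 - y"] assms
  unfolding kl_def by simp

text \<open>The difference \<open>kl x y - kl x z\<close> is affine in x, with nonnegative slope
  because y \<le> z. At x = z it equals \<open>kl z y\<close>, which is nonnegative, so it stays
  nonnegative for x \<ge> z.\<close>

lemma kl_antimono_right:
  assumes "x \<in> {0..1}" "y \<in> {0<..<1}" "z \<in> {0<..<1}" "y \<le> z" "z \<le> x"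
  shows "kl x z \<le> kl x y"
proof -
  have "0 \<le> kl z y" using assms by (intro kl_nonneg) auto
  also have "kl z y = z * (ln z - ln y) + (1 - z) * (ln (1 - z) - ln (1 - y))"
    using assms by (subst kl_eq) (auto simp: algebra_simps)
  also have "\<dots> \<le> x * (ln z - ln y) + (1 - x) * (ln (1 - z) - ln (1 - y))"
    using assms by (intro add_mono mult_right_mono mult_right_mono_neg) auto
  also have "\<dots> = kl x y - kl x z"
    using assms by (simp add: kl_eq algebra_simps)
  finally show ?thesis by simp
qed

text \<open>First-order expansion of \<open>kl\<close> in its first argument around x. The remainder
  is exactly \<open>kl x' x\<close>, so convexity follows from \<open>kl_nonneg\<close> without any
  derivative.\<close>

lemma kl_tangent:
  assumes "t \<in> {0<..<1}" "x \<in> {0<..<1}" "x' \<in> {0..1}"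
  shows "kl x' t = kl x' x + kl x t + (x' - x) * ((ln x - ln t) + (ln (1 - t) - ln (1 - x)))"
  using assms by (simp add: kl_eq algebra_simps)

lemma kl_strict_mono_left:
  assumes "t \<in> {0<..<1}" "t < x" "x < x'" "x' \<le> 1"
  shows "kl x t < kl x' t"
proof -
  have x: "x \<in> {0<..<1}" using assms by auto
  have "kl x' x \<ge> 0" using assms x by (intro kl_nonneg) auto
  \<comment> \<open>The slope of the tangent at x is positive because t < x.\<close>
  moreover have "(x' - x) * ((ln x - ln t) + (ln (1 - t) - ln (1 - x))) > 0"
    using assms x by (intro mult_pos_pos add_pos_pos) auto
  ultimately show ?thesis using kl_tangent[of t x x'] assms x by auto
qed

lemma kl_self: "x \<in> {0<..<1} \<Longrightarrow> kl x x = 0"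
  by (simp add: kl_def)

lemma kl_mono_left:
  assumes "t \<in> {0<..<1}" "t \<le> x" "x \<le> x'" "x' \<le> 1"
  shows "kl x t \<le> kl x' t"
  using assms kl_strict_mono_left[of t x x'] kl_nonneg[of x' t] kl_self[of t]
  by (cases "x = x'"; cases "t = x") auto

lemma continuous_on_mult_ln: "continuous_on {0..} (\<lambda>u::real. u * ln u)"
proof -
  have "continuous (at u within {0..}) (\<lambda>u::real. u * ln u)" if "u \<ge> 0" for u
  proof (cases "u = 0")
    case True
    \<comment> \<open>The function takes the value 0 at 0, since the factor u vanishes there, so
      this limit is continuity.\<close>
    have "((\<lambda>u::real. u * ln u) \<longlongrightarrow> 0) (at_right 0)" by real_asymp
    then show ?thesis
      using True by (simp add: continuous_within at_within_Ici_at_right)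
  next
    case False
    then show ?thesis using that by (intro continuous_intros) auto
  qed
  then show ?thesis by (simp add: continuous_on_eq_continuous_within)
qed

text \<open>Continuity up to the endpoint 1 is what lets the intermediate value theorem be applied
  on [t,1].\<close>

lemma continuous_on_kl_left:
  assumes "t \<in> {0<..<1}"
  shows "continuous_on {0..1} (\<lambda>x. kl x t)"
proof -
  have "continuous_on {0..1::real} (\<lambda>x. (1 - x) * ln (1 - x))"
    by (rule continuous_on_compose2[OF continuous_on_mult_ln]) (auto intro!: continuous_intros)
  moreover have "continuous_on {0..1::real} (\<lambda>x. x * ln x)"
    by (rule continuous_on_subset[OF continuous_on_mult_ln]) auto
  ultimately have "continuous_on {0..1}
      (\<lambda>x. x * ln x - x * ln t + (1 - x) * ln (1 - x) - (1 - x) * ln (1 - t))"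
    by (intro continuous_on_add continuous_on_diff continuous_on_mult_right
          continuous_on_const continuous_on_id) auto
  then show ?thesis
    by (rule continuous_on_eq) (use assms in \<open>auto simp: kl_eq\<close>)
qed

section \<open>Sublevel sets of the relative entropy and the confidence bounds they define\<close>

lemma bern_rel_entropy_self: "x \<in> {0..1} \<Longrightarrow> bern_rel_entropy x x = 0"
  by (auto simp: bern_rel_entropy_def)

lemma bern_rel_entropy_compl: "bern_rel_entropy (1 - x) (1 - y) = bern_rel_entropy x y"
  by (auto simp: bern_rel_entropy_def)

text \<open>Compactness makes the extrema in \<open>lower_conf\<close> and \<open>upper_conf\<close>
  attained; without this \<open>LEAST\<close> and \<open>GREATEST\<close> would carry no
  information.\<close>

lemma compact_bern_rel_entropy_sublevel:
  assumes "x \<in> {0..1}"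
  shows "compact {y \<in> {0..1}. bern_rel_entropy x y \<le> ereal c}"
proof -
  consider "x = 0" | "x = 1" | "x \<in> {0<..<1}" using assms by fastforce
  then show ?thesis
  proof cases
    case 1
    \<comment> \<open>The bound \<open>1 - exp (- c)\<close> is below 1, so it also excludes the
      singular point y = 1.\<close>
    have "bern_rel_entropy 0 y \<le> ereal c \<longleftrightarrow> y \<le> 1 - exp (- c)" if "y \<in> {0..1}" for y
      using that ln_ge_iff[of "1 - y" "- c"] by (auto simp: bern_rel_entropy_def ln_div)
    then have "{y \<in> {0..1}. bern_rel_entropy x y \<le> ereal c} = {0..1} \<inter> {..1 - exp (-c)}"
      using 1 by blast
    then show ?thesis by (simp add: compact_Int_closed)
  next
    case 2
    have "bern_rel_entropy 1 y \<le> ereal c \<longleftrightarrow> y \<ge> exp (- c)" if "y \<in> {0..1}" for y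
      using that ln_ge_iff[of "y" "- c"] by (auto simp: bern_rel_entropy_def ln_div)
    then have "{y \<in> {0..1}. bern_rel_entropy x y \<le> ereal c} = {0..1} \<inter> {exp (-c)..}"
      using 2 by blast
    then show ?thesis by (simp add: compact_Int_closed)
  next
    case 3
    \<comment> \<open>Exponentiating turns the singularities at 0 and 1 into zeros of a continuous function.\<close>
    define h where "h = (\<lambda>y. y powr x * (1 - y) powr (1 - x))"
    have "bern_rel_entropy x y \<le> ereal c \<longleftrightarrow> h y \<ge> exp (- c) * h x" if "y \<in> {0..1}" for y
    proof (cases "y \<in> {0<..<1}")
      case True
      have "h y = exp (x * ln y + (1 - x) * ln (1 - y))"
        using True by (simp add: h_def powr_def exp_add)
      moreover have "h x = exp (x * ln x + (1 - x) * ln (1 - x))"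
        using 3 by (simp add: h_def powr_def exp_add)
      ultimately have "h y \<ge> exp (- c) * h x \<longleftrightarrow>
          - c + (x * ln x + (1 - x) * ln (1 - x)) \<le> x * ln y + (1 - x) * ln (1 - y)"
        by (simp flip: exp_add)
      then show ?thesis
        using 3 True by (auto simp: bern_rel_entropy_eq_kl kl_eq)
    next
      case False
      then have "y = 0 \<or> y = 1" using that by auto
      then have "h y = 0" "bern_rel_entropy x y = \<infinity>"
        using 3 by (auto simp: h_def bern_rel_entropy_def)
      moreover have "h x > 0" using 3 by (simp add: h_def)
      ultimately show ?thesis by (auto simp: mult_le_0_iff)
    qed
    then have "{y \<in> {0..1}. bern_rel_entropy x y \<le> ereal c} = {0..1} \<inter> h -` {exp (- c) * h x..}"
      by blast
    moreover have "continuous_on {0..1} h"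
      unfolding h_def using 3 by (intro continuous_intros continuous_on_powr') auto
    ultimately show ?thesis
      by (auto simp: compact_eq_bounded_closed intro!: continuous_closed_preimage bounded_Int)
  qed
qed

lemma conf_bounds:
  fixes m :: nat
  assumes x: "x \<in> {0..1}" and "0 < \<delta>" "\<delta> < 1"
  defines "c \<equiv> ln (1 / \<delta>) / real m"
  shows lower_conf_le: "lower_conf x m \<delta> \<le> x"
    and lower_conf_nonneg: "0 \<le> lower_conf x m \<delta>"
    and lower_conf_entropy: "bern_rel_entropy x (lower_conf x m \<delta>) \<le> ereal c"
    and lower_conf_least:
      "\<And>y. y \<in> {0..1} \<Longrightarrow> bern_rel_entropy x y \<le> ereal c \<Longrightarrow> lower_conf x m \<delta> \<le> y"
proof -
  define K where "K = {y \<in> {0..1}. bern_rel_entropy x y \<le> ereal c}"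
  have "c \<ge> 0" using assms by simp
  \<comment> \<open>The sublevel set is nonempty, and its least element is at most x, because d(x,x)
    = 0 \<le> c.\<close>
  then have "x \<in> K" using x by (auto simp: K_def bern_rel_entropy_self)
  moreover have "compact K" unfolding K_def by (rule compact_bern_rel_entropy_sublevel[OF x])
  ultimately obtain l where l: "l \<in> K" "\<And>y. y \<in> K \<Longrightarrow> l \<le> y"
    using compact_attains_inf[of K] by auto
  have "lower_conf x m \<delta> = l"
    unfolding lower_conf_def using l by (intro Least_equality) (auto simp: K_def c_def)
  then show "lower_conf x m \<delta> \<le> x" "0 \<le> lower_conf x m \<delta>"
    "bern_rel_entropy x (lower_conf x m \<delta>) \<le> ereal c"
    "\<And>y. y \<in> {0..1} \<Longrightarrow> bern_rel_entropy x y \<le> ereal c \<Longrightarrow> lower_conf x m \<delta> \<le> y"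
    using l \<open>x \<in> K\<close> by (auto simp: K_def)
qed

text \<open>The relative entropy is invariant under replacing both arguments by their complements.
  This reflection exchanges the two ends of the sublevel set.\<close>

lemma upper_conf_eq:
  assumes x: "x \<in> {0..1}" and \<delta>: "0 < \<delta>" "\<delta> < 1"
  shows "upper_conf x m \<delta> = 1 - lower_conf (1 - x) m \<delta>"
proof -
  have x': "1 - x \<in> {0..1}" using x by simp
  note * = conf_bounds[OF x' \<delta>, where m = m]
  show ?thesis
    unfolding upper_conf_def
  proof (rule Greatest_equality)
    show "1 - lower_conf (1 - x) m \<delta> \<in> {0..1} \<and>
      bern_rel_entropy x (1 - lower_conf (1 - x) m \<delta>) \<le> ereal (ln (1 / \<delta>) / real m)"
      using *(1-3) x bern_rel_entropy_compl[of x "1 - lower_conf (1 - x) m \<delta>"] by auto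
    show "y \<le> 1 - lower_conf (1 - x) m \<delta>"
      if "y \<in> {0..1} \<and> bern_rel_entropy x y \<le> ereal (ln (1 / \<delta>) / real m)" for y
      using *(4)[of "1 - y"] that bern_rel_entropy_compl[of x y] by auto
  qed
qed

text \<open>If L > t, then t lies below x and outside the sublevel set. Conversely, to the left of x
  the entropy only grows as y decreases, so once it exceeds the level at t no y \<le> t can be
  admissible.\<close>

lemma lower_conf_gt_iff:
  assumes x: "x \<in> {0..1}" and \<delta>: "0 < \<delta>" "\<delta> < 1" and t: "t \<in> {0<..<1}"
  shows "lower_conf x m \<delta> > t \<longleftrightarrow> x > t \<and> kl x t > ln (1 / \<delta>) / real m"
proof -
  note * = conf_bounds[OF x \<delta>, where m = m]
  have xt: "bern_rel_entropy x t = ereal (kl x t)"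
    using x t by (rule bern_rel_entropy_eq_kl)
  show ?thesis
  proof (intro iffI conjI)
    assume gt: "lower_conf x m \<delta> > t"
    then show "x > t" using *(1) by simp
    show "kl x t > ln (1 / \<delta>) / real m"
      using *(4)[of t] gt t xt by (force simp: not_le[symmetric])
  next
    assume A: "x > t \<and> kl x t > ln (1 / \<delta>) / real m"
    show "lower_conf x m \<delta> > t"
    proof (rule ccontr)
      assume "\<not> ?thesis"
      then have le: "lower_conf x m \<delta> \<le> t" by simp
      \<comment> \<open>At y = 0 the entropy is infinite because x > 0; this places the lower bound
        in (0,1), where \<open>kl\<close> applies.\<close>
      have "lower_conf x m \<delta> \<noteq> 0"
        using *(3) A t by (auto simp: bern_rel_entropy_def)
      then have l: "lower_conf x m \<delta> \<in> {0<..<1}" using *(2) le t by auto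
      then have "kl x (lower_conf x m \<delta>) \<le> ln (1 / \<delta>) / real m"
        using *(3) x by (simp add: bern_rel_entropy_eq_kl)
      moreover have "kl x t \<le> kl x (lower_conf x m \<delta>)"
        using x t l le A by (intro kl_antimono_right) auto
      ultimately show False using A by simp
    qed
  qed
qed

text \<open>On [t,1] the map x \<mapsto> \<open>kl x t\<close> rises strictly and continuously from
  0. Either it crosses the positive level ln(1/\<delta>)/m before 1, and x0 is the crossing point,
  or it never exceeds that level and x0 = 1 stands for an empty event.\<close>

lemma lower_conf_threshold:
  assumes \<delta>: "0 < \<delta>" "\<delta> < 1" and t: "t \<in> {0<..<1}" and m: "m \<ge> 1"
  obtains x0 where "t < x0" "x0 \<le> 1"
    and "\<And>x. x \<in> {0..1} \<Longrightarrow> lower_conf x m \<delta> > t \<longleftrightarrow> x > x0"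
    and "x0 < 1 \<Longrightarrow> kl x0 t = ln (1 / \<delta>) / real m"
proof -
  define c where "c = ln (1 / \<delta>) / real m"
  have c: "c > 0" using \<delta> m by (simp add: c_def)
  note iff = lower_conf_gt_iff[OF _ \<delta> t, of _ m, folded c_def]
  show thesis
  proof (cases "kl 1 t \<le> c")
    case True
    have "\<not> lower_conf x m \<delta> > t" if "x \<in> {0..1}" for x
      using iff[OF that] kl_mono_left[OF t, of x 1] True that by auto
    then show thesis using t by (intro that[of 1]) auto
  next
    case False
    have "\<exists>x0\<ge>t. x0 \<le> 1 \<and> kl x0 t = c"
      using c t False continuous_on_subset[OF continuous_on_kl_left[OF t], of "{t..1}"]
      by (intro IVT') (auto simp: kl_self)
    then obtain x0 where x0: "t \<le> x0" "x0 \<le> 1" "kl x0 t = c" by blast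
    have "t \<noteq> x0" "x0 \<noteq> 1" using x0 c t False by (auto simp: kl_self)
    then have x0': "t < x0" "x0 < 1" using x0 by auto
    have "lower_conf x m \<delta> > t \<longleftrightarrow> x > x0" if "x \<in> {0..1}" for x
      using iff[OF that] kl_mono_left[OF t, of x x0] kl_strict_mono_left[OF t, of x0 x]
        x0 x0' that by fastforce
    then show thesis using x0 x0' by (intro that[of x0]) (auto simp: c_def)
  qed
qed

text \<open>If monotonicity failed, some t would separate the two values in the wrong order. But the
  set where the lower bound exceeds t is an upper ray.\<close>

lemma lower_conf_mono:
  assumes \<delta>: "0 < \<delta>" "\<delta> < 1" and m: "m \<ge> 1" and x: "0 \<le> x" "x \<le> x'" "x' \<le> 1"
  shows "lower_conf x m \<delta> \<le> lower_conf x' m \<delta>"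
proof (rule ccontr)
  assume "\<not> ?thesis"
  then have less: "lower_conf x' m \<delta> < lower_conf x m \<delta>" by simp
  then obtain t where t: "lower_conf x' m \<delta> < t" "t < lower_conf x m \<delta>" using dense by blast
  have xx: "x \<in> {0..1}" "x' \<in> {0..1}" using x by auto
  have "t \<in> {0<..<1}"
    using t conf_bounds(1,2)[OF xx(1) \<delta>, of m] conf_bounds(1,2)[OF xx(2) \<delta>, of m] x by auto
  then obtain x0 where iff: "\<And>x. x \<in> {0..1} \<Longrightarrow> lower_conf x m \<delta> > t \<longleftrightarrow> x > x0"
    using lower_conf_threshold[OF \<delta> _ m] by metis
  show False using iff[OF xx(1)] iff[OF xx(2)] t x by linarith
qed

section \<open>Measurability of the confidence bounds\<close>

lemma borel_measurable_lower_conf: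
  assumes \<delta>: "0 < \<delta>" "\<delta> < 1" and m: "m \<ge> 1"
    and f[measurable]: "f \<in> borel_measurable M" and f01: "\<And>w. w \<in> space M \<Longrightarrow> f w \<in> {0..1}"
  shows "(\<lambda>w. lower_conf (f w) m \<delta>) \<in> borel_measurable M"
proof -
  \<comment> \<open>Clamping to [0,1] yields a function monotone on the whole line, hence Borel,
    which agrees with the lower bound on the values of f.\<close>
  define h where "h x = lower_conf (max 0 (min 1 x)) m \<delta>" for x
  have "mono h"
    unfolding h_def by (intro monoI lower_conf_mono \<delta> m) auto
  then have [measurable]: "h \<in> borel_measurable borel" by (rule borel_measurable_mono)
  have "(\<lambda>w. h (f w)) \<in> borel_measurable M" by measurable
  then show ?thesis
    by (rule measurable_cong[THEN iffD1, rotated]) (use f01 in \<open>auto simp: h_def\<close>)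
qed

lemma borel_measurable_upper_conf:
  assumes \<delta>: "0 < \<delta>" "\<delta> < 1" and m: "m \<ge> 1"
    and f[measurable]: "f \<in> borel_measurable M" and f01: "\<And>w. w \<in> space M \<Longrightarrow> f w \<in> {0..1}"
  shows "(\<lambda>w. upper_conf (f w) m \<delta>) \<in> borel_measurable M"
proof -
  have "(\<lambda>w. 1 - lower_conf (1 - f w) m \<delta>) \<in> borel_measurable M"
    using f01 by (intro borel_measurable_diff borel_measurable_lower_conf \<delta> m) auto
  then show ?thesis
    by (rule measurable_cong[THEN iffD1, rotated]) (use f01 \<delta> in \<open>simp add: upper_conf_eq\<close>)
qed

section \<open>Chernoff's bound in relative-entropy form\<close>

lemma (in prob_space) exp_moment_le_bernoulli:
  fixes g :: "'a \<Rightarrow> real"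
  assumes [measurable]: "g \<in> borel_measurable M" and g01: "\<And>q. q \<in> space M \<Longrightarrow> g q \<in> {0..1}"
  shows "integrable M (\<lambda>q. exp (l * g q))"
    and "(\<integral>q. exp (l * g q) \<partial>M) \<le> 1 - expectation g + expectation g * exp l"
proof -
  have g: "integrable M g"
    using g01 by (intro integrable_const_bound[where B = 1]) auto
  \<comment> \<open>By convexity the exponential lies below its chord over [0,1]. Thus the moment
    generating function is at most that of a Bernoulli variable with the same mean.\<close>
  have le: "exp (l * g q) \<le> 1 - g q + g q * exp l" if "q \<in> space M" for q
    using convex_onD[OF exp_convex, of "g q" 0 l] g01[OF that] by (simp add: mult.commute)
  show int: "integrable M (\<lambda>q. exp (l * g q))"
    by (rule Bochner_Integration.integrable_bound[of M "\<lambda>q. 1 - g q + g q * exp l"])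
      (use g le in \<open>auto intro!: AE_I2 order_trans[OF _ abs_ge_self]\<close>)
  have "(\<integral>q. exp (l * g q) \<partial>M) \<le> (\<integral>q. 1 - g q + g q * exp l \<partial>M)"
    using g int le by (intro integral_mono) auto
  also have "\<dots> = 1 - expectation g + expectation g * exp l"
    using g by (simp add: prob_space)
  finally show "(\<integral>q. exp (l * g q) \<partial>M) \<le> 1 - expectation g + expectation g * exp l" .
qed

lemma (in prob_space) expectation_unit_interval:
  assumes [measurable]: "g \<in> borel_measurable M" and g01: "\<And>q. q \<in> space M \<Longrightarrow> g q \<in> {0..1::real}"
  shows "integrable M g" "expectation g \<in> {0..1}"
proof -
  show g: "integrable M g"
    using g01 by (intro integrable_const_bound[where B = 1]) auto
  have "expectation g \<le> expectation (\<lambda>_. 1)" using g g01 by (intro integral_mono) auto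
  moreover have "expectation g \<ge> 0" using g01 by (intro integral_nonneg_AE) auto
  ultimately show "expectation g \<in> {0..1}" by (simp add: prob_space)
qed

lemma (in prob_space) chernoff_kl:
  fixes g :: "'a \<Rightarrow> real" and n :: nat
  assumes [measurable]: "g \<in> borel_measurable M" and g01: "\<And>q. q \<in> space M \<Longrightarrow> g q \<in> {0..1}"
    and \<mu>: "expectation g \<in> {0<..<1}" and x: "expectation g < x" "x < 1"
  defines "P \<equiv> \<Pi>\<^sub>M j\<in>{..<n}. M"
  shows "measure P {w \<in> space P. (\<Sum>j<n. g (w j)) \<ge> real n * x} \<le> exp (- real n * kl x (expectation g))"
proof -
  define m where "m = expectation g"
  \<comment> \<open>the minimiser of \<open>exp (- l * x) * (1 - m + m * exp l)\<close>\<close>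
  define l where "l = ln (x * (1 - m) / (m * (1 - x)))"
  have m: "0 < m" "m < x" "m < 1" using \<mu> x by (auto simp: m_def)
  \<comment> \<open>The odds of x exceed those of m since x > m; this gives the positive l that the
    exponential Markov inequality requires.\<close>
  have ratio: "x * (1 - m) / (m * (1 - x)) > 1"
    using m x by (simp add: field_simps)
  then have l: "l > 0" unfolding l_def by (rule ln_gt_zero)
  have l_eq: "l = ln x + ln (1 - m) - ln m - ln (1 - x)"
    using m x unfolding l_def by (subst ln_div) (auto simp: ln_mult)
  interpret P: prob_space P unfolding P_def by (rule prob_space_PiM) (rule prob_space_axioms)
  interpret product_sigma_finite "\<lambda>_::nat. M" by unfold_locales
  note E = exp_moment_le_bernoulli[of g l, OF assms(1,2)]
  have exp_sum: "exp (l * (\<Sum>j<n. g (w j))) = (\<Prod>j<n. exp (l * g (w j)))" for w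
    by (simp add: sum_distrib_left exp_sum)
  have int: "integrable P (\<lambda>w. exp (l * (\<Sum>j<n. g (w j))))"
    unfolding exp_sum P_def using E(1) by (intro product_integrable_prod) auto
  have "measure P {w \<in> space P. (\<Sum>j<n. g (w j)) \<ge> real n * x}
      \<le> exp (- l * (real n * x)) * (\<integral>w\<in>space P. exp (l * (\<Sum>j<n. g (w j))) \<partial>P)"
    by (intro P.Chernoff_ineq_ge l sets.top)
      (unfold set_integrable_def, intro integrable_mult_indicator sets.top int)
  also have "(\<integral>w\<in>space P. exp (l * (\<Sum>j<n. g (w j))) \<partial>P) = (\<integral>w. exp (l * (\<Sum>j<n. g (w j))) \<partial>P)"
    by (simp add: set_integral_space int)
  also have "\<dots> = (\<integral>q. exp (l * g q) \<partial>M) ^ n"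
    unfolding exp_sum P_def using E(1) by (subst product_integral_prod) auto
  also have "\<dots> \<le> (1 - m + m * exp l) ^ n"
    using E(2) by (intro power_mono) (auto simp: m_def)
  \<comment> \<open>By the choice of l, \<open>m * exp l\<close> equals x(1 - m)/(1 - x), and the
    two terms share the factor 1 - m.\<close>
  also have "1 - m + m * exp l = (1 - m) / (1 - x)"
    using m x by (simp add: l_def field_simps)
  also have "\<dots> = exp (ln (1 - m) - ln (1 - x))"
    using m x by (simp add: exp_diff)
  also have "exp (- l * (real n * x)) * exp (ln (1 - m) - ln (1 - x)) ^ n
      = exp (real n * (- (l * x) + (ln (1 - m) - ln (1 - x))))"
    by (simp add: exp_of_nat_mult[symmetric] exp_add[symmetric] algebra_simps)
  also have "- (l * x) + (ln (1 - m) - ln (1 - x)) = - kl x m"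
    using m x by (simp add: kl_eq l_eq algebra_simps)
  finally show ?thesis by (simp add: m_def)
qed

section \<open>Coverage of the confidence bounds for sample means\<close>

lemma sample_mean:
  fixes g :: "'a \<Rightarrow> real" and n :: nat
  assumes g[measurable]: "g \<in> borel_measurable M" and g01: "\<And>q. q \<in> space M \<Longrightarrow> g q \<in> {0..1}"
  shows borel_measurable_sample_mean:
      "(\<lambda>w. (\<Sum>j<n. g (w j)) / real n) \<in> borel_measurable (\<Pi>\<^sub>M j\<in>{..<n}. M)"
    and sample_mean_unit_interval:
      "\<And>w. w \<in> space (\<Pi>\<^sub>M j\<in>{..<n}. M) \<Longrightarrow> (\<Sum>j<n. g (w j)) / real n \<in> {0..1}"
proof -
  show "(\<lambda>w. (\<Sum>j<n. g (w j)) / real n) \<in> borel_measurable (\<Pi>\<^sub>M j\<in>{..<n}. M)"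
    by measurable
  fix w assume "w \<in> space (\<Pi>\<^sub>M j\<in>{..<n}. M)"
  then have "g (w j) \<in> {0..1}" if "j < n" for j
    using that by (intro g01) (auto simp: space_PiM)
  then show "(\<Sum>j<n. g (w j)) / real n \<in> {0..1}"
    using sum_bounded_above[of "{..<n}" "\<lambda>j. g (w j)" 1]
    by (cases "n = 0") (auto intro!: divide_nonneg_nonneg sum_nonneg)
qed

lemma (in prob_space) prob_lower_conf_gt_mean_le:
  fixes g :: "'a \<Rightarrow> real" and n :: nat
  assumes g[measurable]: "g \<in> borel_measurable M" and g01: "\<And>q. q \<in> space M \<Longrightarrow> g q \<in> {0..1}"
    and \<delta>: "0 < \<delta>" "\<delta> < 1" and n: "n \<ge> 1"
  defines "P \<equiv> \<Pi>\<^sub>M j\<in>{..<n}. M"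
  shows "measure P {w \<in> space P. lower_conf ((\<Sum>j<n. g (w j)) / real n) n \<delta> > expectation g} \<le> \<delta>"
    (is "measure P ?E \<le> _")
proof -
  interpret P: prob_space P unfolding P_def by (rule prob_space_PiM) (rule prob_space_axioms)
  define mean where "mean w = (\<Sum>j<n. g (w j)) / real n" for w
  have mean_meas: "mean \<in> borel_measurable P"
    unfolding mean_def P_def by (rule borel_measurable_sample_mean[OF g g01])
  have mean01: "mean w \<in> {0..1}" if "w \<in> space P" for w
    using that unfolding mean_def P_def by (intro sample_mean_unit_interval[where g = g and M = M] g g01)
  have L[measurable]: "(\<lambda>w. lower_conf (mean w) n \<delta>) \<in> borel_measurable P"
    by (rule borel_measurable_lower_conf[OF \<delta> n mean_meas mean01])
  have E_sets: "?E \<in> sets P" unfolding mean_def[symmetric] by measurable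
  have E: "?E = {w \<in> space P. lower_conf (mean w) n \<delta> > expectation g}"
    by (simp add: mean_def)
  note Eg = expectation_unit_interval[OF g g01]
  then consider "expectation g = 0" | "expectation g = 1" | "expectation g \<in> {0<..<1}"
    by fastforce
  then show "measure P ?E \<le> \<delta>"
  proof cases
    case 1
    \<comment> \<open>A nonnegative variable of mean 0 vanishes almost surely; so does the sample
      mean, which bounds L from above.\<close>
    have "AE q in M. g q = 0"
      using integral_nonneg_eq_0_iff_AE[of M g] Eg g01 1 by auto
    then have "AE w in P. g (w j) = 0" if "j < n" for j
      unfolding P_def using that by (intro AE_PiM_component prob_space_axioms) auto
    then have "AE w in P. \<forall>j\<in>{..<n}. g (w j) = 0"
      by (intro AE_finite_allI) auto
    then have "AE w in P. w \<notin> ?E"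
    proof (rule AE_mp, intro AE_I2 impI)
      fix w assume "w \<in> space P" "\<forall>j\<in>{..<n}. g (w j) = 0"
      then have "lower_conf (mean w) n \<delta> \<le> 0"
        using conf_bounds(1)[OF mean01 \<delta>, of w n] by (simp add: mean_def)
      then show "w \<notin> ?E" unfolding E using 1 by auto
    qed
    then have "measure P ?E = 0"
      using E_sets by (simp add: P.prob_eq_0)
    then show ?thesis using \<delta> by simp
  next
    case 2
    have "lower_conf (mean w) n \<delta> \<le> 1" if "w \<in> space P" for w
      using conf_bounds(1)[OF mean01[OF that] \<delta>, of n] mean01[OF that] by simp
    then have "?E = {}" unfolding E by (auto simp: 2 not_less)
    then show ?thesis using \<delta> by (simp only: measure_empty)
  next
    case 3
    then obtain x0 where x0: "expectation g < x0" "x0 \<le> 1"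
      and iff: "\<And>x. x \<in> {0..1} \<Longrightarrow> lower_conf x n \<delta> > expectation g \<longleftrightarrow> x > x0"
      and kl: "x0 < 1 \<Longrightarrow> kl x0 (expectation g) = ln (1 / \<delta>) / real n"
      using lower_conf_threshold[OF \<delta> _ n] by blast
    have E': "?E = {w \<in> space P. mean w > x0}"
      unfolding E using iff mean01 by auto
    show ?thesis
    proof (cases "x0 = 1")
      case True
      then have "?E = {}" unfolding E' using mean01 by fastforce
      then show ?thesis using \<delta> by (simp only: measure_empty)
    next
      case False
      then have "x0 < 1" using x0 by simp
      have "measure P ?E \<le> measure P {w \<in> space P. (\<Sum>j<n. g (w j)) \<ge> real n * x0}"
      proof (rule P.finite_measure_mono)
        show "?E \<subseteq> {w \<in> space P. (\<Sum>j<n. g (w j)) \<ge> real n * x0}"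
          unfolding E' using n by (auto simp: mean_def field_simps)
        show "{w \<in> space P. (\<Sum>j<n. g (w j)) \<ge> real n * x0} \<in> sets P"
          unfolding P_def by measurable
      qed
      also have "\<dots> \<le> exp (- real n * kl x0 (expectation g))"
        unfolding P_def using 3 x0 \<open>x0 < 1\<close> by (intro chernoff_kl g g01)
      \<comment> \<open>The exponent at the threshold is exactly -ln(1/\<delta>).\<close>
      also have "\<dots> = \<delta>" using kl[OF \<open>x0 < 1\<close>] n \<delta> by (simp add: ln_div)
      finally show ?thesis .
    qed
  qed
qed

text \<open>Apply the bound for lower limits to 1 - g: by \<open>upper_conf_eq\<close> the two
  failure events coincide.\<close>

lemma (in prob_space) prob_upper_conf_less_mean_le:
  fixes g :: "'a \<Rightarrow> real" and n :: nat
  assumes g[measurable]: "g \<in> borel_measurable M" and g01: "\<And>q. q \<in> space M \<Longrightarrow> g q \<in> {0..1}"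
    and \<delta>: "0 < \<delta>" "\<delta> < 1" and n: "n \<ge> 1"
  defines "P \<equiv> \<Pi>\<^sub>M j\<in>{..<n}. M"
  shows "measure P {w \<in> space P. upper_conf ((\<Sum>j<n. g (w j)) / real n) n \<delta> < expectation g} \<le> \<delta>"
    (is "measure P ?E \<le> _")
proof -
  have g': "(\<lambda>q. 1 - g q) \<in> borel_measurable M" "\<And>q. q \<in> space M \<Longrightarrow> 1 - g q \<in> {0..1}"
    using g01 by auto
  have Eg: "expectation (\<lambda>q. 1 - g q) = 1 - expectation g"
    using expectation_unit_interval[OF g g01] by (simp add: prob_space)
  have "upper_conf ((\<Sum>j<n. g (w j)) / real n) n \<delta> =
      1 - lower_conf ((\<Sum>j<n. 1 - g (w j)) / real n) n \<delta>" if "w \<in> space P" for w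
  proof -
    have "(\<Sum>j<n. g (w j)) / real n \<in> {0..1}"
      using that unfolding P_def by (intro sample_mean_unit_interval[where g = g and M = M] g g01)
    moreover have "1 - (\<Sum>j<n. g (w j)) / real n = (\<Sum>j<n. 1 - g (w j)) / real n"
      using n by (simp add: sum_subtractf field_simps)
    ultimately show ?thesis by (simp only: upper_conf_eq[OF _ \<delta>])
  qed
  then have "?E = {w \<in> space P.
      lower_conf ((\<Sum>j<n. 1 - g (w j)) / real n) n \<delta> > expectation (\<lambda>q. 1 - g q)}"
    unfolding Eg by auto
  then show ?thesis
    using prob_lower_conf_gt_mean_le[OF g' \<delta> n] unfolding P_def by simp
qed

section \<open>Decomposition of expectations into explained and unexplained parts\<close>

lemma integral_uniform_measure:
  fixes f :: "'a \<Rightarrow> real"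
  assumes [measurable]: "f \<in> borel_measurable M" and A[measurable]: "A \<in> sets M"
    and pos: "0 < measure M A"
  shows "(\<integral>x. f x \<partial>uniform_measure M A) = (\<integral>x\<in>A. f x \<partial>M) / measure M A"
proof -
  \<comment> \<open>Finiteness comes from \<open>pos\<close>: \<open>measure\<close> returns 0 on
    sets of infinite mass.\<close>
  have "emeasure M A = ennreal (measure M A)"
    using pos by (intro emeasure_eq_ennreal_measure) (auto simp: measure_def)
  then have "uniform_measure M A = density M (\<lambda>x. ennreal (indicator A x / measure M A))"
    unfolding uniform_measure_def using pos
    by (intro density_cong) (auto simp: divide_ennreal simp flip: ennreal_1 split: split_indicator)
  then have "(\<integral>x. f x \<partial>uniform_measure M A) = (\<integral>x. (indicator A x / measure M A) *\<^sub>R f x \<partial>M)"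
    by (simp add: integral_density)
  also have "\<dots> = (\<integral>x. (indicator A x *\<^sub>R f x) / measure M A \<partial>M)"
    by simp
  finally show ?thesis unfolding set_lebesgue_integral_def by simp
qed

lemma (in prob_space) measure_unexplained_set:
  assumes "finite E" "\<And>\<alpha>. \<alpha> \<in> E \<Longrightarrow> App \<alpha> \<in> sets M" "disjoint_family_on App E"
  shows "measure M (unexplained_set M E App) = unexplained_prob M E App"
proof -
  have "(\<Union>\<alpha>\<in>E. App \<alpha>) \<in> sets M" using assms by auto
  from prob_compl[OF this] show ?thesis
    using finite_measure_finite_Union[of E App] assms
    by (auto simp: unexplained_set_def unexplained_prob_def)
qed

text \<open>Law of total expectation over the applicability sets and their complement. A general g
  allows it to serve both the score and the indicator of a ridiculous answer.\<close>

lemma (in prob_space) expectation_split: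
  fixes g :: "'a \<Rightarrow> real"
  assumes g[measurable]: "g \<in> borel_measurable M" and g01: "\<And>q. q \<in> space M \<Longrightarrow> g q \<in> {0..1}"
    and E: "finite E" and App: "\<And>\<alpha>. \<alpha> \<in> E \<Longrightarrow> App \<alpha> \<in> sets M" and disj: "disjoint_family_on App E"
    and v: "\<And>\<alpha> q. \<alpha> \<in> E \<Longrightarrow> q \<in> App \<alpha> \<Longrightarrow> g q = v \<alpha>"
    and pos: "unexplained_prob M E App > 0"
  shows "expectation g = (\<Sum>\<alpha>\<in>E. measure M (App \<alpha>) * v \<alpha>) +
    unexplained_prob M E App * (\<integral>q. g q \<partial>uniform_measure M (unexplained_set M E App))"
proof -
  let ?B = "unexplained_set M E App" and ?C = "\<Union>\<alpha>\<in>E. App \<alpha>"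
  have C[measurable]: "?C \<in> sets M" using E App by auto
  then have B[measurable]: "?B \<in> sets M" by (auto simp: unexplained_set_def)
  have B_prob: "measure M ?B = unexplained_prob M E App"
    by (rule measure_unexplained_set[OF E App disj])
  have int: "set_integrable M X g" if "X \<in> sets M" for X
    using that g01 expectation_unit_interval(1)[OF g g01] unfolding set_integrable_def
    by (intro integrable_mult_indicator)
  have "expectation g = (\<integral>q\<in>space M. g q \<partial>M)"
    using expectation_unit_interval(1)[OF g g01] by (simp add: set_integral_space)
  also have "space M = ?C \<union> ?B"
    using sets.sets_into_space[OF C] by (auto simp: unexplained_set_def)
  also have "(\<integral>q\<in>?C \<union> ?B. g q \<partial>M) = (\<integral>q\<in>?C. g q \<partial>M) + (\<integral>q\<in>?B. g q \<partial>M)"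
    by (intro set_integral_Un int B C) (auto simp: unexplained_set_def)
  also have "(\<integral>q\<in>?C. g q \<partial>M) = (\<Sum>\<alpha>\<in>E. \<integral>q\<in>App \<alpha>. g q \<partial>M)"
    by (intro set_integral_finite_Union E disj int App)
  also have "\<dots> = (\<Sum>\<alpha>\<in>E. measure M (App \<alpha>) * v \<alpha>)"
  proof (intro sum.cong refl)
    fix \<alpha> assume \<alpha>: "\<alpha> \<in> E"
    have "(\<integral>q\<in>App \<alpha>. g q \<partial>M) = (\<integral>q\<in>App \<alpha>. v \<alpha> \<partial>M)"
      using \<alpha> App v by (intro set_lebesgue_integral_cong) auto
    then show "(\<integral>q\<in>App \<alpha>. g q \<partial>M) = measure M (App \<alpha>) * v \<alpha>"
      using App[OF \<alpha>] by (simp add: set_lebesgue_integral_def)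
  qed
  also have "(\<integral>q\<in>?B. g q \<partial>M) = unexplained_prob M E App * (\<integral>q. g q \<partial>uniform_measure M ?B)"
    using pos B_prob by (simp add: integral_uniform_measure)
  finally show ?thesis .
qed

section \<open>Error probabilities of the testing procedure\<close>

theorem theorem2:
  fixes \<Delta> :: "'q measure" and A :: "'a set" and idk :: 'a and S :: "'q \<Rightarrow> 'a \<Rightarrow> real"
    and PG RID \<delta> :: real and ans :: "'q \<Rightarrow> 'a"
    and E :: "'e set" and App :: "'e \<Rightarrow> 'q set" and sc :: "'e \<Rightarrow> real" and n :: nat
  defines "P \<equiv> sample_measure \<Delta> E App n"
    and "U \<equiv> understands \<Delta> S PG RID ans"
    and "det_U \<equiv> determines_understands \<Delta> S PG RID ans E App sc n \<delta>"
    and "det_not_U \<equiv> determines_not_understands \<Delta> S PG RID ans E App sc n \<delta>"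
  assumes "qa_domain \<Delta> A idk S"
    and "0 < PG" and "PG < 1" and "0 < RID" and "RID < 1"
    and "ans \<in> space \<Delta> \<rightarrow> A"
    and "(\<lambda>q. S q (ans q)) \<in> borel_measurable \<Delta>"
    and "finite E"
    and "\<And>\<alpha>. \<alpha> \<in> E \<Longrightarrow> App \<alpha> \<in> sets \<Delta>"
    and "disjoint_family_on App E"
    and "\<And>\<alpha>. \<alpha> \<in> E \<Longrightarrow> sc \<alpha> \<in> {0..1}"
    and "\<And>\<alpha> q. \<alpha> \<in> E \<Longrightarrow> q \<in> App \<alpha> \<Longrightarrow> S q (ans q) = sc \<alpha>"
    and "unexplained_prob \<Delta> E App > 0"
    and "0 < \<delta>" and "\<delta> < 1"
    and "n \<ge> 1"
  shows "measure P {qs \<in> space P. (det_U qs \<longrightarrow> U) \<and> (det_not_U qs \<longrightarrow> \<not> U)} \<ge> 1 - \<delta> \<and>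
    (\<not> U \<longrightarrow> measure P {qs \<in> space P. det_U qs} \<le> \<delta>) \<and>
    (U \<longrightarrow> measure P {qs \<in> space P. det_not_U qs} \<le> \<delta>)"
proof -
  interpret D: qa_domain \<Delta> A idk S by fact
  define B where "B = unexplained_set \<Delta> E App"
  define p where "p = unexplained_prob \<Delta> E App"
  define M where "M = uniform_measure \<Delta> B"
  define f where "f q = S q (ans q)" for q
  define r where "r q = ridiculous_score (f q)" for q
  have p: "p > 0" using assms by (simp add: p_def)
  have "measure \<Delta> B = p"
    unfolding B_def p_def using assms by (intro D.measure_unexplained_set)
  then have "emeasure \<Delta> B \<noteq> 0" using p by (auto simp: measure_def)
  then interpret M: prob_space M
    unfolding M_def by (intro prob_space_uniform_measure) auto
  have P_eq: "P = (\<Pi>\<^sub>M j\<in>{..<n}. M)"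
    by (simp add: P_def sample_measure_def M_def B_def)
  interpret P: prob_space P
    unfolding P_eq by (rule prob_space_PiM) (rule M.prob_space_axioms)
  have fD[measurable]: "f \<in> borel_measurable \<Delta>" using assms by (simp add: f_def[abs_def])
  have rD[measurable]: "r \<in> borel_measurable \<Delta>" unfolding r_def ridiculous_score_def by measurable
  have fM: "f \<in> borel_measurable M" and rM: "r \<in> borel_measurable M"
    unfolding M_def by measurable
  have sp: "space M = space \<Delta>" by (simp add: M_def)
  have f01: "f q \<in> {0..1}" if "q \<in> space \<Delta>" for q
    unfolding f_def using that assms by (intro D.score_range) auto
  have r01: "r q \<in> {0..1}" for q by (simp add: r_def ridiculous_score_def)
  have fM01: "\<And>q. q \<in> space M \<Longrightarrow> f q \<in> {0..1}" and rM01: "\<And>q. q \<in> space M \<Longrightarrow> r q \<in> {0..1}"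
    using f01 r01 by (auto simp: sp)

  have s: "expected_score \<Delta> S ans = explained_score \<Delta> E App sc + p * M.expectation f"
    unfolding expected_score_def explained_score_def f_def[symmetric] p_def M_def B_def
    by (rule D.expectation_split) (use assms f01 in \<open>auto simp: f_def\<close>)
  \<comment> \<open>Written as an expectation, the ridiculous probability splits in the same way as
    the score.\<close>
  have "ridiculous_prob \<Delta> S ans = D.expectation (indicator {q \<in> space \<Delta>. f q = 0})"
    by (simp add: ridiculous_prob_def ridiculous_def f_def Int_def conj_commute)
  also have "\<dots> = D.expectation r"
    by (intro Bochner_Integration.integral_cong) (auto simp: r_def ridiculous_score_def)
  also have "\<dots> = explained_ridiculous \<Delta> E App sc + p * M.expectation r"
    unfolding explained_ridiculous_def p_def M_def B_def
    by (rule D.expectation_split) (use assms r01 in \<open>auto simp: r_def f_def\<close>)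
  finally have rid: "ridiculous_prob \<Delta> S ans = explained_ridiculous \<Delta> E App sc + p * M.expectation r" .

  define ls us lr ur where "ls d qs = lower_conf (mean_score S ans n qs) n d"
    and "us d qs = upper_conf (mean_score S ans n qs) n d"
    and "lr d qs = lower_conf (mean_ridiculous S ans n qs) n d"
    and "ur d qs = upper_conf (mean_ridiculous S ans n qs) n d" for d qs
  have mean_f: "mean_score S ans n = (\<lambda>qs. (\<Sum>j<n. f (qs j)) / real n)"
    and mean_r: "mean_ridiculous S ans n = (\<lambda>qs. (\<Sum>j<n. r (qs j)) / real n)"
    by (simp_all add: fun_eq_iff mean_score_def mean_ridiculous_def f_def r_def)
  note conf_defs = ls_def us_def lr_def ur_def mean_f mean_r
  have meas: "ls d \<in> borel_measurable P" "us d \<in> borel_measurable P"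
    "lr d \<in> borel_measurable P" "ur d \<in> borel_measurable P" if "0 < d" "d < 1" for d
  proof -
    have "(\<lambda>qs. lower_conf ((\<Sum>j<n. g (qs j)) / real n) n d) \<in> borel_measurable P \<and>
        (\<lambda>qs. upper_conf ((\<Sum>j<n. g (qs j)) / real n) n d) \<in> borel_measurable P"
      if "g \<in> borel_measurable M" "\<And>q. q \<in> space M \<Longrightarrow> g q \<in> {0..1}" for g
      unfolding P_eq using that \<open>0 < d\<close> \<open>d < 1\<close> \<open>n \<ge> 1\<close>
      by (intro conjI borel_measurable_lower_conf borel_measurable_upper_conf
            borel_measurable_sample_mean sample_mean_unit_interval[where g = g and M = M])
    from this[OF fM fM01] this[OF rM rM01]
    show "ls d \<in> borel_measurable P" "us d \<in> borel_measurable P"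
      "lr d \<in> borel_measurable P" "ur d \<in> borel_measurable P"
      unfolding conf_defs[abs_def] by blast+
  qed
  have bounds: "P.prob {qs \<in> space P. ls d qs > M.expectation f} \<le> d"
    "P.prob {qs \<in> space P. us d qs < M.expectation f} \<le> d"
    "P.prob {qs \<in> space P. lr d qs > M.expectation r} \<le> d"
    "P.prob {qs \<in> space P. ur d qs < M.expectation r} \<le> d" if "0 < d" "d < 1" for d
    using M.prob_lower_conf_gt_mean_le[OF fM fM01 that \<open>n \<ge> 1\<close>]
      M.prob_upper_conf_less_mean_le[OF fM fM01 that \<open>n \<ge> 1\<close>]
      M.prob_lower_conf_gt_mean_le[OF rM rM01 that \<open>n \<ge> 1\<close>]
      M.prob_upper_conf_less_mean_le[OF rM rM01 that \<open>n \<ge> 1\<close>]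
    unfolding conf_defs P_eq by simp_all

  have half: "0 < \<delta> / 2" "\<delta> / 2 < 1" using assms by auto
  note [measurable] = meas[OF \<open>0 < \<delta>\<close> \<open>\<delta> < 1\<close>] meas[OF half]
  let ?es = "explained_score \<Delta> E App sc" and ?er = "explained_ridiculous \<Delta> E App sc"
  have U_iff: "U \<longleftrightarrow> PG \<le> ?es + p * M.expectation f \<and> ?er + p * M.expectation r \<le> RID"
    by (simp add: U_def understands_def s rid)
  have det_U_iff: "det_U = (\<lambda>qs. PG \<le> ?es + p * ls \<delta> qs \<and> ?er + p * ur \<delta> qs \<le> RID)"
    by (simp add: fun_eq_iff det_U_def determines_understands_def ls_def ur_def p_def)
  have det_not_U_iff: "det_not_U = (\<lambda>qs. ?es + p * us (\<delta> / 2) qs < PG \<or> RID < ?er + p * lr (\<delta> / 2) qs)"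
    by (simp add: fun_eq_iff det_not_U_def determines_not_understands_def us_def lr_def p_def)
  have sets_det_U: "{qs \<in> space P. det_U qs} \<in> P.events"
    unfolding det_U_iff by measurable
  have sets_det_not_U: "{qs \<in> space P. det_not_U qs} \<in> P.events"
    unfolding det_not_U_iff by measurable
  \<comment> \<open>When an estimate and the true value lie on opposite sides of PG or RID,
    cancelling the explained part and p > 0 shows that the confidence bound has missed its
    mean.\<close>
  have less_if: "x < y" if "a + p * x < c" "c \<le> a + p * y" for a c x y
  proof -
    have "p * x < p * y" using that by linarith
    then show ?thesis using p by simp
  qed
  have le_less_if: "x < y" if "a + p * x \<le> c" "c < a + p * y" for a c x y
  proof -
    have "p * x < p * y" using that by linarith
    then show ?thesis using p by simp
  qed

  \<comment> \<open>Acceptance requires both inequalities, so a single violated criterion suffices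
    to bound its probability. No union bound is taken, and each confidence bound may use the full
    \<delta>.\<close>
  have det_U_le: "P.prob {qs \<in> space P. det_U qs} \<le> \<delta>" if "\<not> U"
  proof (cases "?es + p * M.expectation f < PG")
    case True
    have "P.prob {qs \<in> space P. det_U qs} \<le> P.prob {qs \<in> space P. ls \<delta> qs > M.expectation f}"
      using less_if[OF True] by (intro P.finite_measure_mono) (auto simp: det_U_iff)
    then show ?thesis using bounds(1)[of \<delta>] assms by linarith
  next
    case False
    then have "RID < ?er + p * M.expectation r" using that U_iff by auto
    then have "P.prob {qs \<in> space P. det_U qs} \<le> P.prob {qs \<in> space P. ur \<delta> qs < M.expectation r}"
      using le_less_if by (intro P.finite_measure_mono) (auto simp: det_U_iff)
    then show ?thesis using bounds(4)[of \<delta>] assms by linarith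
  qed
  have det_not_U_le: "P.prob {qs \<in> space P. det_not_U qs} \<le> \<delta>" if U
  proof -
    let ?A = "{qs \<in> space P. us (\<delta> / 2) qs < M.expectation f}"
      and ?B = "{qs \<in> space P. lr (\<delta> / 2) qs > M.expectation r}"
    \<comment> \<open>Rejection is a disjunction: either of two bounds may have failed, each with
      probability at most \<delta>/2.\<close>
    have "P.prob {qs \<in> space P. det_not_U qs} \<le> P.prob (?A \<union> ?B)"
      using that less_if le_less_if
      by (intro P.finite_measure_mono) (auto simp: det_not_U_iff U_iff)
    also have "\<dots> \<le> P.prob ?A + P.prob ?B"
      by (intro measure_Un_le) measurable
    also have "\<dots> \<le> \<delta>"
      using bounds(2,3)[OF half] by linarith
    finally show ?thesis .
  qed
  \<comment> \<open>\<open>U\<close> does not depend on the sample, so only one of the two kinds of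
    error is possible and the total error is \<delta> rather than 2\<delta>.\<close>
  have "P.prob {qs \<in> space P. (det_U qs \<longrightarrow> U) \<and> (det_not_U qs \<longrightarrow> \<not> U)} \<ge> 1 - \<delta>"
    using det_U_le det_not_U_le P.prob_neg[OF sets_det_U] P.prob_neg[OF sets_det_not_U]
    by (cases U) auto
  then show ?thesis using det_U_le det_not_U_le by blast
qed

end
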